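(* For the infinite planar grid $P_\infty\,\Box\,P_\infty$, $$\frac{\alpha_{\mathrm{od}}(C_4\,\Box\,C_4)}{4^2}\ \le\ \varrho_{\mathrm{od}}(P_\infty\,\Box\,P_\infty)\ \le\ \frac{\alpha_{\mathrm{iod}}(P_{26}\,\Box\,P_{26})}{26^2};$$ more explicitly, $$\frac38\ \le\ \varrho_{\mathrm{od}}(P_\infty\,\Box\,P_\infty)\ \le\ \frac{260}{676}=\frac{5}{13}.$$
   Context: $\Box$ is the Cartesian product of graphs; $P_k$, $C_k$ are the path and cycle on $k$ vertices. $P_\infty\,\Box\,P_\infty$ is the infinite grid with vertex set $\mathbb{Z}^2$, two vertices being adjacent iff they agree in one coordinate and differ by exactly $1$ in the other. $N(v)$ is the open neighborhood of $v$. An odd independent set in a (finite, or infinite locally finite) graph $G=(V,E)$ is an independent set $S\subseteq V$ such that for every $v\in V\setminus S$, either $N(v)\cap S=\varnothing$ or $|N(v)\cap S|$ is odd. For finite $G$, $\alpha_{\mathrm{od}}(G)$ is the largest cardinality of an odd independent set. For the infinite grid, the odd independence density is $\varrho_{\mathrm{od}}:=\sup_S \limsup_{H_n,\ n\to\infty} |S\cap V(H_n)|/|V(H_n)|$, where $S$ ranges over all odd independent sets of the grid and $H_n$ ranges over all subgraphs induced by the vertices in axis-parallel $n\times n$ squares (so $H_n\cong P_n\,\Box\,P_n$). For $k\ge 3$, an internally odd-independent set is an independent set $S\subseteq V(P_k\,\Box\,P_k)$ such that every vertex of degree $4$ in $P_k\,\Box\,P_k$ (i.e. every vertex not on the boundary)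 either belongs to $S$, or has no neighbor in $S$, or has an odd number of neighbors in $S$; $\alpha_{\mathrm{iod}}(P_k\,\Box\,P_k)$ is the largest cardinality of such a set. *)

theory Defs
  imports "HOL-Library.Extended_Real" "HOL-Library.Liminf_Limsup"
begin

record 'v ugraph =
  verts :: "'v set"
  adj :: "'v \<Rightarrow> 'v \<Rightarrow> bool"

definition path_graph :: "nat \<Rightarrow> nat ugraph" where
  "path_graph k = \<lparr> verts = {..<k},
     adj = (\<lambda>u v. u < k \<and> v < k \<and> (v = Suc u \<or> u = Suc v)) \<rparr>"

text \<open>A simple graph only for \<open>k \<noteq> 1\<close>, and the cycle on \<open>k\<close> vertices for \<open>k \<ge> 3\<close>.\<close>

definition cycle_graph :: "nat \<Rightarrow> nat ugraph" where
  "cycle_graph k = \<lparr> verts = {..<k},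
     adj = (\<lambda>u v. u < k \<and> v < k \<and> (v = Suc u mod k \<or> u = Suc v mod k)) \<rparr>"

text \<open>The two-way infinite path.\<close>

definition path_inf :: "int ugraph" where
  "path_inf = \<lparr> verts = UNIV, adj = (\<lambda>u v. \<bar>u - v\<bar> = 1) \<rparr>"

definition cart_prod :: "'a ugraph \<Rightarrow> 'b ugraph \<Rightarrow> ('a \<times> 'b) ugraph" (infixl "\<box>" 70) where
  "G \<box> H = \<lparr> verts = verts G \<times> verts H,
     adj = (\<lambda>(a, b) (c, d). (a = c \<and> a \<in> verts G \<and> adj H b d) \<or>
                            (b = d \<and> b \<in> verts H \<and> adj G a c)) \<rparr>"

lemma verts_grid: "verts (path_inf \<box> path_inf) = UNIV"
  by (simp add: cart_prod_def path_inf_def)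

lemma adj_grid:
  "adj (path_inf \<box> path_inf) (a, b) (c, d) \<longleftrightarrow>
     (a = c \<and> \<bar>b - d\<bar> = 1) \<or> (b = d \<and> \<bar>a - c\<bar> = 1)"
  by (simp add: cart_prod_def path_inf_def)

definition nbhd :: "'v ugraph \<Rightarrow> 'v \<Rightarrow> 'v set" where
  "nbhd G v = {u \<in> verts G. adj G v u}"

definition degree :: "'v ugraph \<Rightarrow> 'v \<Rightarrow> nat" where
  "degree G v = card (nbhd G v)"

definition independent :: "'v ugraph \<Rightarrow> 'v set \<Rightarrow> bool" where
  "independent G S \<longleftrightarrow> S \<subseteq> verts G \<and> (\<forall>u\<in>S. \<forall>v\<in>S. \<not> adj G u v)"

text \<open>For locally finite graphs; on an infinite intersection \<open>card\<close> would be \<open>0\<close>.\<close>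

definition odd_independent :: "'v ugraph \<Rightarrow> 'v set \<Rightarrow> bool" where
  "odd_independent G S \<longleftrightarrow> independent G S \<and>
     (\<forall>v \<in> verts G - S. nbhd G v \<inter> S = {} \<or> odd (card (nbhd G v \<inter> S)))"

text \<open>For finite graphs.\<close>

definition alpha_od :: "'v ugraph \<Rightarrow> nat" where
  "alpha_od G = Max (card ` {S. odd_independent G S})"

text \<open>For the finite grids \<open>path_graph k \<box> path_graph k\<close>, whose vertices of degree 4 are exactly
  the non-boundary ones.\<close>

definition internally_odd_independent :: "'v ugraph \<Rightarrow> 'v set \<Rightarrow> bool" where
  "internally_odd_independent G S \<longleftrightarrow> independent G S \<and>
     (\<forall>v \<in> verts G. degree G v = 4 \<longrightarrow>
        v \<in> S \<or> nbhd G v \<inter> S = {} \<or> odd (card (nbhd G v \<inter> S)))"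

definition alpha_iod :: "'v ugraph \<Rightarrow> nat" where
  "alpha_iod G = Max (card ` {S. internally_odd_independent G S})"

definition square :: "int \<times> int \<Rightarrow> nat \<Rightarrow> (int \<times> int) set" where
  "square p n = {fst p ..< fst p + int n} \<times> {snd p ..< snd p + int n}"

text \<open>The limit superior over all \<open>n \<times> n\<close> squares as \<open>n\<close> tends to infinity: the position
  of the square may vary freely with \<open>n\<close>, hence the inner supremum over positions.\<close>

definition upper_density :: "(int \<times> int) set \<Rightarrow> ereal" where
  "upper_density S =
     limsup (\<lambda>n. SUP p. ereal (real (card (S \<inter> square p n)) / real (card (square p n))))"

definition rho_od_grid :: ereal where
  "rho_od_grid = (SUP S \<in> {S. odd_independent (path_inf \<box> path_inf) S}. upper_density S)"

end

theory Submission
  imports Defs "HOL-Library.Product_Plus"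
begin

text \<open>
  Upper bound \<open>5/13\<close>. Let \<open>S\<close> be an odd independent set of the grid and call a vertex outside
  \<open>S\<close> an \<open>i\<close>-vertex if it has \<open>i\<close> neighbours in \<open>S\<close>; only \<open>i \<in> {0, 1, 3}\<close> occurs. A 3-vertex
  \<open>u\<close> has exactly one neighbour \<open>w\<close> outside \<open>S\<close>, and \<open>w\<close> is not a 3-vertex: otherwise, for a
  step \<open>e\<close> perpendicular to the edge \<open>uw\<close>, the adjacent vertices \<open>u + e\<close> and \<open>w + e\<close> would both
  lie in \<open>S\<close> (lemma \<open>gap_not_trivalent\<close>). So, with \<open>s\<close>, \<open>n\<^sub>0\<close>, \<open>n\<^sub>1\<close>, \<open>n\<^sub>3\<close> the
  densities of \<open>S\<close> and of the three kinds of vertices, counting the edges that leave \<open>S\<close> gives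
  \<open>4 s = n\<^sub>1 + 3 n\<^sub>3\<close>, and counting the pairs \<open>(u, w)\<close> gives \<open>n\<^sub>3 \<le> 4 n\<^sub>0 + 3 n\<^sub>1\<close>. Hence
  \<open>8 s = 2 n\<^sub>1 + 6 n\<^sub>3 \<le> 5 (n\<^sub>0 + n\<^sub>1 + n\<^sub>3) = 5 (1 - s)\<close>, that is \<open>13 s \<le> 5\<close>. To control
  the boundary of an \<open>n \<times> n\<close> square, the two counts are written as one inequality per vertex
  (lemma \<open>discharging\<close>) in which charge is exchanged between adjacent vertices only; in the sum
  over the square the exchanges cancel up to \<open>O(n)\<close>. No value of \<open>alpha_iod\<close> has to be computed.

  Upper bound by \<open>alpha_iod\<close>. Up to translation, \<open>S\<close> meets every \<open>k \<times> k\<close> square in an internally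
  odd-independent set, because a vertex of degree 4 has all its grid neighbours inside the square;
  and an \<open>n \<times> n\<close> square is covered by at most \<open>(n/k + 1)\<^sup>2\<close> such tiles.

  Lower bounds. For \<open>k \<ge> 3\<close> the projection of the grid onto the \<open>k \<times> k\<close> torus maps the
  neighbourhood of each vertex bijectively onto the neighbourhood of its image, so the preimage of
  an odd independent set \<open>T\<close> of the torus is odd independent, and it has density
  \<open>|T| / k\<^sup>2\<close>. On the \<open>4 \<times> 4\<close> torus there is such a set with six elements.
\<close>

section \<open>Neighbourhoods in the grid\<close>

abbreviation grid :: "(int \<times> int) ugraph" where
  "grid \<equiv> path_inf \<box> path_inf"

text \<open>The four differences between a vertex of the grid and its neighbours.\<close>

definition unit_steps :: "(int \<times> int) set" where
  "unit_steps = {(1, 0), (-1, 0), (0, 1), (0, -1)}"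

lemma finite_unit_steps [simp]: "finite unit_steps"
  and card_unit_steps [simp]: "card unit_steps = 4"
  by (simp_all add: unit_steps_def)

lemma uminus_unit_steps: "uminus ` unit_steps = unit_steps"
  by (auto simp: unit_steps_def)

lemma adj_grid_iff: "adj grid u v \<longleftrightarrow> v - u \<in> unit_steps"
  by (cases u; cases v) (auto simp: adj_grid unit_steps_def)

lemma nbhd_grid: "nbhd grid v = (\<lambda>d. v + d) ` unit_steps"
proof (intro equalityI subsetI)
  fix u assume "u \<in> nbhd grid v"
  then show "u \<in> (\<lambda>d. v + d) ` unit_steps"
    by (intro image_eqI[of _ _ "u - v"]) (simp_all add: nbhd_def adj_grid_iff)
qed (auto simp: nbhd_def verts_grid adj_grid_iff)

lemma card_nbhd_grid: "card (nbhd grid v \<inter> S) = (\<Sum>d\<in>unit_steps. of_bool (v + d \<in> S))"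
proof -
  have "nbhd grid v \<inter> S = (\<lambda>d. v + d) ` {d \<in> unit_steps. v + d \<in> S}"
    by (auto simp: nbhd_grid)
  then have "card (nbhd grid v \<inter> S) = card {d \<in> unit_steps. v + d \<in> S}"
    by (simp add: card_image inj_on_def)
  then show ?thesis by (simp add: sum_of_bool_eq Int_def)
qed

lemma odd_independent_gridD:
  assumes "odd_independent grid S"
  shows "\<And>v d. v \<in> S \<Longrightarrow> d \<in> unit_steps \<Longrightarrow> v + d \<notin> S"
    and "\<And>v. v \<notin> S \<Longrightarrow> card (nbhd grid v \<inter> S) \<in> {0, 1, 3}"
proof -
  show "v + d \<notin> S" if "v \<in> S" "d \<in> unit_steps" for v d
  proof
    assume "v + d \<in> S"
    then have "\<not> adj grid v (v + d)"
      using assms that by (simp add: odd_independent_def independent_def)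
    then show False using that by (simp add: adj_grid_iff)
  qed
next
  fix v assume "v \<notin> S"
  then have *: "nbhd grid v \<inter> S = {} \<or> odd (card (nbhd grid v \<inter> S))"
    using assms by (auto simp: odd_independent_def verts_grid)
  have "card (nbhd grid v \<inter> S) \<le> card (nbhd grid v)"
    by (rule card_mono) (auto simp: nbhd_grid)
  also have "\<dots> \<le> 4"
    unfolding nbhd_grid using card_image_le[of unit_steps "\<lambda>d. v + d"] by simp
  finally have "card (nbhd grid v \<inter> S) \<in> {0, 1, 2, 3, 4}" by auto
  then show "card (nbhd grid v \<inter> S) \<in> {0, 1, 3}"
    using * by auto
qed

section \<open>Discharging\<close>

text \<open>The vertex \<open>v\<close> lies outside \<open>S\<close> and has three neighbours in \<open>S\<close>, the remaining one being
  \<open>v + d\<close> (when \<open>d\<close> is a unit step).\<close>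

definition gap_dir :: "(int \<times> int) set \<Rightarrow> int \<times> int \<Rightarrow> int \<times> int \<Rightarrow> bool" where
  "gap_dir S d v \<longleftrightarrow> v \<notin> S \<and> v + d \<notin> S \<and> card (nbhd grid v \<inter> S) = 3"

lemma all_but_one:
  assumes "card (nbhd grid v \<inter> S) = 3" "d \<in> unit_steps" "v + d \<notin> S"
    and "e \<in> unit_steps" "e \<noteq> d"
  shows "v + e \<in> S"
proof (rule ccontr)
  assume "v + e \<notin> S"
  then have "nbhd grid v \<inter> S \<subseteq> (\<lambda>d. v + d) ` (unit_steps - {d, e})"
    using assms(3) by (auto simp: nbhd_grid)
  then have "card (nbhd grid v \<inter> S) \<le> card (unit_steps - {d, e})"
    by (rule surj_card_le[rotated]) simp
  also have "\<dots> = 2"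
    using assms(2,4,5) by (simp add: card_Diff_subset)
  finally show False using assms(1) by simp
qed

lemma gap_not_trivalent:
  assumes S: "odd_independent grid S" and d: "d \<in> unit_steps"
    and gap: "gap_dir S d u"
  shows "card (nbhd grid (u + d) \<inter> S) \<noteq> 3"
proof
  assume 3: "card (nbhd grid (u + d) \<inter> S) = 3"
  define e where "e = (snd d, fst d)"
  have e: "e \<in> unit_steps" "e \<noteq> d" "e \<noteq> - d"
    using d by (auto simp: unit_steps_def e_def)
  have "u + e \<in> S"
    using gap d e by (intro all_but_one[of u S d e]) (auto simp: gap_dir_def)
  moreover have "(u + d) + e \<in> S"
  proof (rule all_but_one[of _ _ "- d"])
    show "- d \<in> unit_steps" using d uminus_unit_steps by blast
  qed (use gap 3 e in \<open>auto simp: gap_dir_def\<close>)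
  then have "(u + e) + d \<in> S" by (simp add: ac_simps)
  ultimately show False
    using odd_independent_gridD(1)[OF S _ d] by blast
qed

text \<open>
  The two brackets are the net charge that \<open>v\<close> receives. In the first, every element of \<open>S\<close> sends
  2 to each of its neighbours; in the second, every vertex with three neighbours in \<open>S\<close> sends 1 to
  its fourth neighbour. An element of \<open>S\<close> is left with \<open>13 - 8 = 5\<close>; a vertex outside \<open>S\<close> with
  \<open>N\<close> neighbours in \<open>S\<close> ends with at most \<open>2 N + (4 - N)\<close>, which is at most 5 if \<open>N \<le> 1\<close>, and
  with \<open>6 - 1 = 5\<close> if \<open>N = 3\<close>.
\<close>

lemma discharging:
  assumes S: "odd_independent grid S"
  shows "13 * of_bool (v \<in> S) + 2 * (\<Sum>d\<in>unit_steps. of_bool (v + d \<in> S) - of_bool (v \<in> S))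
           + (\<Sum>d\<in>unit_steps. of_bool (gap_dir S d (v - d)) - of_bool (gap_dir S d v)) \<le> (5::real)"
proof (cases "v \<in> S")
  case True
  have "\<not> gap_dir S d (v - d)" "\<not> gap_dir S d v" for d
    using True by (auto simp: gap_dir_def)
  moreover have "v + d \<notin> S" if "d \<in> unit_steps" for d
    using odd_independent_gridD(1)[OF S True that] .
  ultimately show ?thesis
    using True by simp
next
  case False
  define N where "N = card (nbhd grid v \<inter> S)"
  have N: "N \<in> {0, 1, 3}"
    using odd_independent_gridD(2)[OF S False] by (simp add: N_def)
  have sum_N: "(\<Sum>d\<in>unit_steps. of_bool (v + d \<in> S)) = real N"
    by (simp add: N_def card_nbhd_grid)
  define I where "I = (\<Sum>d\<in>unit_steps. of_bool (gap_dir S d (v - d)) :: real)"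
  define J where "J = (\<Sum>d\<in>unit_steps. of_bool (gap_dir S d v) :: real)"
  \<comment> \<open>Charge of the second kind comes only from neighbours outside \<open>S\<close>.\<close>
  have I_le: "I \<le> 4 - real N"
  proof -
    have "I \<le> (\<Sum>d\<in>unit_steps. 1 - of_bool (v - d \<in> S))"
      unfolding I_def by (intro sum_mono) (auto simp: gap_dir_def)
    also have "\<dots> = (\<Sum>d\<in>uminus ` unit_steps. 1 - of_bool (v + d \<in> S))"
      by (subst sum.reindex) (auto simp: inj_on_def)
    also have "\<dots> = 4 - real N"
      by (simp add: uminus_unit_steps sum_subtractf sum_N)
    finally show ?thesis .
  qed
  have J_nonneg: "J \<ge> 0"
    unfolding J_def by (intro sum_nonneg) auto
  have "2 * real N + I - J \<le> 5"
  proof (cases "N = 3")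
    case True
    have "I = 0"
      unfolding I_def
    proof (intro sum.neutral ballI)
      fix d assume "d \<in> unit_steps"
      from gap_not_trivalent[OF S this, of "v - d"] show "of_bool (gap_dir S d (v - d)) = (0::real)"
        using True by (auto simp: N_def)
    qed
    moreover have "J = (\<Sum>d\<in>unit_steps. 1 - of_bool (v + d \<in> S))"
      unfolding J_def using True False by (intro sum.cong) (auto simp: gap_dir_def N_def)
    then have "J = 1"
      by (simp add: sum_subtractf sum_N True)
    ultimately show ?thesis using True by simp
  next
    case False
    then show ?thesis using N I_le J_nonneg by auto
  qed
  then show ?thesis
    using False by (simp add: sum_subtractf sum_N I_def J_def)
qed

section \<open>Summation over squares\<close>

lemma finite_square [simp]: "finite (square p n)"
  by (simp add: square_def)

lemma card_square [simp]: "card (square p n) = n * n"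
  by (simp add: square_def)

lemma shift_square: "(\<lambda>v. v + d) ` square p n = square (p + d) n"
proof -
  have "x \<in> (\<lambda>v. v + d) ` square p n" if "x \<in> square (p + d) n" for x
    using that by (intro image_eqI[of _ _ "x - d"]) (auto simp: square_def mem_Times_iff)
  moreover have "x + d \<in> square (p + d) n" if "x \<in> square p n" for x
    using that by (auto simp: square_def mem_Times_iff)
  ultimately show ?thesis by blast
qed

lemma card_square_diff_shift:
  assumes "d \<in> unit_steps"
  shows "card (square p n - square (p + d) n) \<le> n"
proof -
  obtain a b where p: "p = (a, b)" by (cases p)
  let ?D = "square p n - square (p + d) n"
  let ?A = "{a..<a + int n}" and ?B = "{b..<b + int n}"
  consider "d = (1, 0)" | "d = (-1, 0)" | "d = (0, 1)" | "d = (0, -1)"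
    using assms by (auto simp: unit_steps_def)
  then show ?thesis
  proof cases
    case 1
    then have "?D \<subseteq> {a} \<times> ?B" by (auto simp: square_def p)
    from card_mono[OF _ this] show ?thesis by simp
  next
    case 2
    then have "?D \<subseteq> {a + int n - 1} \<times> ?B" by (auto simp: square_def p)
    from card_mono[OF _ this] show ?thesis by simp
  next
    case 3
    then have "?D \<subseteq> ?A \<times> {b}" by (auto simp: square_def p)
    from card_mono[OF _ this] show ?thesis by simp
  next
    case 4
    then have "?D \<subseteq> ?A \<times> {b + int n - 1}" by (auto simp: square_def p)
    from card_mono[OF _ this] show ?thesis by simp
  qed
qed

lemma sum_square_le_shift:
  fixes g :: "int \<times> int \<Rightarrow> real"
  assumes d: "d \<in> unit_steps" and g: "\<And>v. 0 \<le> g v" "\<And>v. g v \<le> 1"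
  shows "(\<Sum>v\<in>square p n. g v) \<le> (\<Sum>v\<in>square p n. g (v + d)) + real n"
proof -
  let ?Q = "square p n" and ?R = "square (p + d) n"
  have "(\<Sum>v\<in>?Q. g v) \<le> (\<Sum>v\<in>?R \<union> (?Q - ?R). g v)"
    by (intro sum_mono2) (auto simp: g)
  also have "\<dots> = (\<Sum>v\<in>?R. g v) + (\<Sum>v\<in>?Q - ?R. g v)"
    by (intro sum.union_disjoint) auto
  also have "(\<Sum>v\<in>?Q - ?R. g v) \<le> real (card (?Q - ?R)) * 1"
    by (intro sum_bounded_above g)
  also have "\<dots> \<le> real n"
    using card_square_diff_shift[OF d] by simp
  also have "(\<Sum>v\<in>?R. g v) = (\<Sum>v\<in>?Q. g (v + d))"
    unfolding shift_square[symmetric] by (subst sum.reindex) (auto simp: inj_on_def)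
  finally show ?thesis by simp
qed

lemma card_odd_independent_square:
  assumes S: "odd_independent grid S"
  shows "13 * real (card (S \<inter> square p n)) \<le> 5 * real n ^ 2 + 12 * real n"
proof -
  let ?Q = "square p n"
  let ?chi = "\<lambda>v. of_bool (v \<in> S) :: real" and ?t = "\<lambda>d v. of_bool (gap_dir S d v) :: real"
  have A: "(\<Sum>v\<in>?Q. ?chi (v + d) - ?chi v) \<ge> - real n" if "d \<in> unit_steps" for d
    using sum_square_le_shift[OF that, of ?chi p n] by (simp add: sum_subtractf)
  have B: "(\<Sum>v\<in>?Q. ?t d (v - d) - ?t d v) \<ge> - real n" if "d \<in> unit_steps" for d
  proof -
    have "- d \<in> unit_steps" using that uminus_unit_steps by blast
    from sum_square_le_shift[OF this, of "?t d" p n] show ?thesis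
      by (simp add: sum_subtractf)
  qed
  have "(\<Sum>v\<in>?Q. 13 * ?chi v + 2 * (\<Sum>d\<in>unit_steps. ?chi (v + d) - ?chi v)
           + (\<Sum>d\<in>unit_steps. ?t d (v - d) - ?t d v)) \<le> real (card ?Q) * 5"
    by (intro sum_bounded_above discharging S)
  also have "(\<Sum>v\<in>?Q. 13 * ?chi v + 2 * (\<Sum>d\<in>unit_steps. ?chi (v + d) - ?chi v)
           + (\<Sum>d\<in>unit_steps. ?t d (v - d) - ?t d v))
      = 13 * (\<Sum>v\<in>?Q. ?chi v) + 2 * (\<Sum>d\<in>unit_steps. \<Sum>v\<in>?Q. ?chi (v + d) - ?chi v)
         + (\<Sum>d\<in>unit_steps. \<Sum>v\<in>?Q. ?t d (v - d) - ?t d v)"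
    unfolding sum.distrib sum_distrib_left[symmetric] by (simp only: sum.swap[of _ unit_steps])
  finally have "13 * (\<Sum>v\<in>?Q. ?chi v) + 2 * (\<Sum>d\<in>unit_steps. \<Sum>v\<in>?Q. ?chi (v + d) - ?chi v)
         + (\<Sum>d\<in>unit_steps. \<Sum>v\<in>?Q. ?t d (v - d) - ?t d v) \<le> 5 * real n ^ 2"
    by (simp add: power2_eq_square)
  moreover have "(\<Sum>d\<in>unit_steps. \<Sum>v\<in>?Q. ?chi (v + d) - ?chi v) \<ge> 4 * - real n"
    using sum_bounded_below[of unit_steps "- real n", OF A] by simp
  moreover have "(\<Sum>d\<in>unit_steps. \<Sum>v\<in>?Q. ?t d (v - d) - ?t d v) \<ge> 4 * - real n"
    using sum_bounded_below[of unit_steps "- real n", OF B] by simp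
  moreover have "(\<Sum>v\<in>?Q. ?chi v) = real (card (S \<inter> ?Q))"
    by (simp add: sum_of_bool_eq Int_commute)
  ultimately show ?thesis by linarith
qed

section \<open>The density is at most 5/13\<close>

lemma upper_density_le:
  assumes "\<And>p n. real (card (S \<inter> square p n)) \<le> c * real n ^ 2 + C * real n"
  shows "upper_density S \<le> ereal c"
proof -
  have le: "(SUP p. ereal (real (card (S \<inter> square p n)) / real (card (square p n))))
          \<le> ereal (c + C / real n)" if "n > 0" for n
    using that assms[of _ n]
    by (intro SUP_least) (simp add: field_simps power2_eq_square)
  have "(\<lambda>n. C / real n) \<longlonglongrightarrow> 0"
    by (rule lim_const_over_n)
  then have "(\<lambda>n. ereal (c + C / real n)) \<longlonglongrightarrow> ereal c"
    using tendsto_add[of "\<lambda>_. c" c sequentially "\<lambda>n. C / real n" 0] by simp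
  then have "limsup (\<lambda>n. ereal (c + C / real n)) = ereal c"
    by (intro lim_imp_Limsup) auto
  moreover have "upper_density S \<le> limsup (\<lambda>n. ereal (c + C / real n))"
    unfolding upper_density_def
    by (intro Limsup_mono eventually_mono[OF eventually_gt_at_top[of 0]] le)
  ultimately show ?thesis by simp
qed

lemma rho_od_grid_le_5_13: "rho_od_grid \<le> ereal (5 / 13)"
  unfolding rho_od_grid_def
proof (rule SUP_least, clarify)
  fix S :: "(int \<times> int) set" assume "odd_independent grid S"
  from card_odd_independent_square[OF this] show "upper_density S \<le> ereal (5 / 13)"
    by (intro upper_density_le[of _ _ "12 / 13"]) (simp add: field_simps)
qed

section \<open>Tiling by finite grids\<close>

lemma finite_independent_sets:
  assumes "finite (verts G)"
  shows "finite {S. odd_independent G S}" "finite {S. internally_odd_independent G S}"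
  by (rule finite_subset[of _ "Pow (verts G)"];
      use assms in \<open>auto simp: odd_independent_def internally_odd_independent_def independent_def\<close>)+

lemma card_le_alpha_od:
  assumes "finite (verts G)" "odd_independent G S"
  shows "card S \<le> alpha_od G"
  unfolding alpha_od_def using assms by (auto intro!: Max_ge simp: finite_independent_sets)

lemma card_le_alpha_iod:
  assumes "finite (verts G)" "internally_odd_independent G S"
  shows "card S \<le> alpha_iod G"
  unfolding alpha_iod_def using assms by (auto intro!: Max_ge simp: finite_independent_sets)

lemma alpha_od_attained:
  assumes "finite (verts G)"
  obtains S where "odd_independent G S" "card S = alpha_od G"
proof -
  have "odd_independent G {}"
    by (simp add: odd_independent_def independent_def)
  then have "alpha_od G \<in> card ` {S. odd_independent G S}"
    unfolding alpha_od_def by (intro Max_in) (auto simp: finite_independent_sets assms)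
  then show ?thesis using that by auto
qed

lemma verts_path_square: "verts (path_graph k \<box> path_graph k) = {..<k} \<times> {..<k}"
  by (simp add: cart_prod_def path_graph_def)

lemma verts_cycle_square: "verts (cycle_graph k \<box> cycle_graph k) = {..<k} \<times> {..<k}"
  by (simp add: cart_prod_def cycle_graph_def)


text \<open>A vertex of degree 4 is not on the boundary: its neighbourhood embeds into a grid neighbourhood
  of the same size.\<close>

lemma nbhd_path_square:
  assumes v: "v \<in> verts (path_graph k \<box> path_graph k)"
    and deg: "degree (path_graph k \<box> path_graph k) v = 4"
  shows "(\<lambda>(a, b). (int a, int b)) ` nbhd (path_graph k \<box> path_graph k) v
           = nbhd grid (case v of (a, b) \<Rightarrow> (int a, int b))"
proof -
  let ?G = "path_graph k \<box> path_graph k" and ?i = "\<lambda>(a, b). (int a, int b)"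
  have "?i ` nbhd ?G v \<subseteq> nbhd grid (?i v)"
    by (auto simp: nbhd_def cart_prod_def path_graph_def path_inf_def)
  moreover have "card (?i ` nbhd ?G v) = 4"
    using deg by (subst card_image) (auto simp: inj_on_def degree_def)
  moreover have "card (nbhd grid (?i v)) = 4"
    unfolding nbhd_grid by (subst card_image) (auto simp: inj_on_def)
  moreover have "finite (nbhd grid (?i v))"
    by (simp add: nbhd_grid)
  ultimately show ?thesis
    by (intro card_subset_eq) auto
qed

lemma card_square_le_alpha_iod:
  assumes S: "odd_independent grid S"
  shows "card (S \<inter> square p k) \<le> alpha_iod (path_graph k \<box> path_graph k)"
proof -
  let ?G = "path_graph k \<box> path_graph k" and ?i = "\<lambda>(a, b). (int a, int b)"
  define f where "f v = p + ?i v" for v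
  define T where "T = {v \<in> verts ?G. f v \<in> S}"
  have inj: "inj_on f A" for A by (auto simp: inj_on_def f_def)
  have adj_i: "adj grid (f u) (f v)" if "adj ?G u v" for u v
    using that by (cases p) (auto simp: f_def cart_prod_def path_graph_def path_inf_def)
  have "S \<inter> square p k \<subseteq> f ` T"
  proof
    fix u assume u: "u \<in> S \<inter> square p k"
    let ?v = "(nat (fst (u - p)), nat (snd (u - p)))"
    have "u = f ?v"
      using u by (auto simp: f_def square_def mem_Times_iff prod_eq_iff)
    moreover from this have "?v \<in> T"
      using u by (auto simp: T_def square_def mem_Times_iff verts_path_square)
    ultimately show "u \<in> f ` T" by blast
  qed
  then have "card (S \<inter> square p k) \<le> card T"
    by (rule surj_card_le[rotated]) (simp add: T_def verts_path_square)
  also have "\<dots> \<le> alpha_iod ?G"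
  proof (rule card_le_alpha_iod)
    have "\<not> adj ?G u v" if "u \<in> T" "v \<in> T" for u v
      using that adj_i[of u v] S by (auto simp: T_def odd_independent_def independent_def)
    moreover have "nbhd ?G v \<inter> T = {} \<or> odd (card (nbhd ?G v \<inter> T))"
      if v: "v \<in> verts ?G" "v \<notin> T" and deg: "degree ?G v = 4" for v
    proof -
      have "nbhd grid (f v) = (\<lambda>u. p + u) ` nbhd grid (?i v)"
        unfolding nbhd_grid image_image by (simp add: f_def ac_simps)
      also have "\<dots> = f ` nbhd ?G v"
        unfolding nbhd_path_square[OF v(1) deg, symmetric] image_image f_def ..
      finally have "nbhd grid (f v) \<inter> S = f ` nbhd ?G v \<inter> S" by (rule arg_cong)
      also have "f ` A \<inter> S = f ` {u \<in> A. f u \<in> S}" for A by blast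
      also have "{u \<in> nbhd ?G v. f u \<in> S} = nbhd ?G v \<inter> T"
        by (auto simp: T_def nbhd_def)
      finally have *: "nbhd grid (f v) \<inter> S = f ` (nbhd ?G v \<inter> T)" .
      have "f v \<notin> S" using v by (simp add: T_def)
      then have "nbhd grid (f v) \<inter> S = {} \<or> odd (card (nbhd grid (f v) \<inter> S))"
        using S by (simp add: odd_independent_def verts_grid)
      then show ?thesis
        unfolding * by (simp add: card_image[OF inj])
    qed
    ultimately show "internally_odd_independent ?G T"
      unfolding internally_odd_independent_def independent_def T_def by blast
  qed (simp add: verts_path_square)
  finally show ?thesis .
qed

lemma card_square_le_of_tiles:
  assumes k: "k > 0" and tile: "\<And>p. card (S \<inter> square p k) \<le> a"
  shows "card (S \<inter> square p n) \<le> (n div k + 1)\<^sup>2 * a"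
proof -
  let ?m = "n div k + 1"
  let ?I = "{..<?m} \<times> {..<?m}"
  let ?tile = "\<lambda>(i, j). square (p + (int (k * i), int (k * j))) k"
  have "u \<in> (\<Union>t\<in>?I. S \<inter> ?tile t)" if u: "u \<in> S \<inter> square p n" for u
  proof -
    define x y where "x = nat (fst u - fst p)" and "y = nat (snd u - snd p)"
    have xy: "fst u = fst p + int x" "snd u = snd p + int y" "x < n" "y < n"
      using u by (auto simp: x_def y_def square_def mem_Times_iff)
    have tile_coord: "k * (z div k) \<le> z" "z < k * (z div k) + k" "z < n \<Longrightarrow> z div k < ?m" for z
      using k dividend_less_times_div[OF k, of z] by (simp_all add: div_le_mono less_Suc_eq_le)
    have "u \<in> ?tile (x div k, y div k)"
      using tile_coord(1,2)[of x] tile_coord(1,2)[of y] xy(1,2)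
      by (simp add: square_def mem_Times_iff del: of_nat_mult)
    then show ?thesis
      using u xy(3,4) tile_coord(3) by blast
  qed
  then have "card (S \<inter> square p n) \<le> card (\<Union>t\<in>?I. S \<inter> ?tile t)"
    by (intro card_mono) auto
  also have "\<dots> \<le> (\<Sum>t\<in>?I. card (S \<inter> ?tile t))"
    by (rule card_UN_le) simp
  also have "\<dots> \<le> (\<Sum>t\<in>?I. a)"
    by (intro sum_mono) (auto intro: tile)
  finally show ?thesis by (simp add: power2_eq_square)
qed

lemma rho_od_grid_le_alpha_iod:
  assumes k: "k > 0"
  shows "rho_od_grid \<le> ereal (real (alpha_iod (path_graph k \<box> path_graph k)) / real k ^ 2)"
  unfolding rho_od_grid_def
proof (rule SUP_least, clarify)
  fix S :: "(int \<times> int) set" assume S: "odd_independent grid S"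
  define a where "a = alpha_iod (path_graph k \<box> path_graph k)"
  have "real (card (S \<inter> square p n))
          \<le> real a / real k ^ 2 * real n ^ 2 + (2 * real a / real k + real a) * real n" for p n
  proof (cases "n = 0")
    case True
    then show ?thesis by (simp add: square_def)
  next
    case False
    have "card (S \<inter> square p n) \<le> (n div k + 1)\<^sup>2 * a"
      using card_square_le_alpha_iod[OF S] unfolding a_def
      by (intro card_square_le_of_tiles k)
    then have "real (card (S \<inter> square p n)) \<le> real ((n div k + 1)\<^sup>2 * a)"
      by (rule of_nat_mono)
    also have "\<dots> = (real (n div k) + 1)\<^sup>2 * a"
      by simp
    also have "\<dots> \<le> (real n / real k + 1)\<^sup>2 * a"
      by (intro mult_right_mono power_mono add_right_mono of_nat_div_le_of_nat) auto
    also have "\<dots> = real a / real k ^ 2 * real n ^ 2 + 2 * real a / real k * real n + real a"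
      using k by (simp add: field_simps power2_eq_square)
    also have "\<dots> \<le> real a / real k ^ 2 * real n ^ 2 + 2 * real a / real k * real n + real a * real n"
      using False by (simp add: mult_le_cancel_left1)
    finally show ?thesis by (simp add: algebra_simps)
  qed
  then show "upper_density S \<le> ereal (real a / real k ^ 2)"
    by (rule upper_density_le)
qed

section \<open>Periodic odd independent sets\<close>

text \<open>The residue of an integer modulo \<open>k\<close>, as a vertex of the cycle (for \<open>k > 0\<close>).\<close>

definition residue :: "nat \<Rightarrow> int \<Rightarrow> nat" where
  "residue k x = nat (x mod int k)"

lemma residue_less: "k > 0 \<Longrightarrow> residue k x < k"
  by (simp add: residue_def nat_less_iff)

lemma residue_eq_iff: "k > 0 \<Longrightarrow> residue k x = residue k y \<longleftrightarrow> int k dvd x - y"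
  by (simp add: residue_def eq_nat_nat_iff mod_eq_dvd_iff)

lemma residue_int: "a < k \<Longrightarrow> residue k (int a + int k * x) = a"
  by (simp add: residue_def)

lemma Suc_residue_mod: "k > 0 \<Longrightarrow> Suc (residue k x) mod k = residue k (x + 1)"
  by (rule of_nat_eq_iff[where 'a = int, THEN iffD1])
     (simp add: residue_def of_nat_mod mod_simps add.commute)

lemma adj_cycle_residue:
  assumes k: "k > 0"
  shows "adj (cycle_graph k) (residue k x) c \<longleftrightarrow> c = residue k (x + 1) \<or> c = residue k (x - 1)"
proof -
  have "residue k x = Suc c mod k \<longleftrightarrow> c = residue k (x - 1)" if "c < k"
  proof -
    have "Suc c mod k = residue k (int c + 1)"
      using Suc_residue_mod[OF k, of "int c"] residue_int[OF that, of 0] by simp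
    moreover have "c = residue k (int c)"
      using residue_int[OF that, of 0] by simp
    ultimately show ?thesis
      using k residue_eq_iff[OF k, of x "int c + 1"] residue_eq_iff[OF k, of "x - 1" "int c"]
      by (metis diff_diff_eq add.commute)
  qed
  then show ?thesis
    using k by (auto simp: cycle_graph_def Suc_residue_mod residue_less)
qed

text \<open>The covering map from the grid onto the Cartesian product of two \<open>k\<close>-cycles.\<close>

definition torus_proj :: "nat \<Rightarrow> int \<times> int \<Rightarrow> nat \<times> nat" where
  "torus_proj k v = (residue k (fst v), residue k (snd v))"

lemma nbhd_torus_proj:
  assumes k: "k > 0"
  shows "nbhd (cycle_graph k \<box> cycle_graph k) (torus_proj k v) = torus_proj k ` nbhd grid v"
proof -
  let ?C = "cycle_graph k \<box> cycle_graph k" and ?r = "residue k"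
  obtain x y where v: "v = (x, y)" by (cases v)
  have "torus_proj k ` nbhd grid v
          = {(?r (x + 1), ?r y), (?r (x - 1), ?r y), (?r x, ?r (y + 1)), (?r x, ?r (y - 1))}"
    by (simp add: nbhd_grid unit_steps_def torus_proj_def v)
  moreover have "adj ?C (torus_proj k v) (c, d) \<longleftrightarrow>
      c = ?r x \<and> (d = ?r (y + 1) \<or> d = ?r (y - 1)) \<or>
      d = ?r y \<and> (c = ?r (x + 1) \<or> c = ?r (x - 1))" for c d
  proof -
    have "adj ?C (torus_proj k v) (c, d) \<longleftrightarrow>
        ?r x = c \<and> adj (cycle_graph k) (?r y) d \<or> ?r y = d \<and> adj (cycle_graph k) (?r x) c"
      using residue_less[OF k] by (simp add: cart_prod_def cycle_graph_def torus_proj_def v)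
    then show ?thesis
      unfolding adj_cycle_residue[OF k] by auto
  qed
  ultimately show ?thesis
    using residue_less[OF k] by (auto simp: nbhd_def[of ?C] verts_cycle_square)
qed

text \<open>Two neighbours of a vertex differ by at most 2 in each coordinate, hence the bound on \<open>k\<close>.\<close>

lemma inj_on_torus_proj:
  assumes k: "k \<ge> 3"
  shows "inj_on (torus_proj k) (nbhd grid v)"
proof -
  have "\<not> int k dvd z" if "z \<noteq> 0" "\<bar>z\<bar> \<le> 2" for z
    using k that dvd_imp_le_int[of z "int k"] by auto
  then show ?thesis
    using k unfolding nbhd_grid unit_steps_def
    by (auto simp: inj_on_def torus_proj_def residue_eq_iff)
qed

lemma odd_independent_periodic:
  assumes k: "k \<ge> 3" and T: "odd_independent (cycle_graph k \<box> cycle_graph k) T"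
  shows "odd_independent grid (torus_proj k -` T)"
proof -
  let ?C = "cycle_graph k \<box> cycle_graph k"
  have nbhd: "nbhd ?C (torus_proj k v) = torus_proj k ` nbhd grid v" for v
    using k by (intro nbhd_torus_proj) auto
  have "\<not> adj grid u v" if "torus_proj k u \<in> T" "torus_proj k v \<in> T" for u v
  proof
    assume "adj grid u v"
    then have "torus_proj k v \<in> nbhd ?C (torus_proj k u)"
      unfolding nbhd by (simp add: nbhd_def verts_grid)
    then show False
      using that T by (auto simp: nbhd_def odd_independent_def independent_def)
  qed
  moreover have "nbhd grid v \<inter> torus_proj k -` T = {} \<or> odd (card (nbhd grid v \<inter> torus_proj k -` T))"
    if "torus_proj k v \<notin> T" for v
  proof -
    have *: "nbhd ?C (torus_proj k v) \<inter> T = torus_proj k ` (nbhd grid v \<inter> torus_proj k -` T)"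
      unfolding nbhd by auto
    have inj: "inj_on (torus_proj k) (nbhd grid v \<inter> torus_proj k -` T)"
      using inj_on_torus_proj[OF k, of v] by (rule inj_on_subset) simp
    have "torus_proj k v \<in> verts ?C"
      using k by (simp add: torus_proj_def verts_cycle_square residue_less)
    then have "nbhd ?C (torus_proj k v) \<inter> T = {} \<or> odd (card (nbhd ?C (torus_proj k v) \<inter> T))"
      using T that by (simp add: odd_independent_def)
    then show ?thesis
      unfolding * by (simp add: card_image[OF inj])
  qed
  ultimately show ?thesis
    by (auto simp: odd_independent_def independent_def verts_grid)
qed

lemma card_periodic_square:
  assumes T: "T \<subseteq> {..<k} \<times> {..<k}"
  shows "m\<^sup>2 * card T \<le> card (torus_proj k -` T \<inter> square (0, 0) (k * m))"
proof -
  let ?f = "\<lambda>((i, j), (a, b)). (int a + int k * int i, int b + int k * int j)"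
  let ?D = "({..<m} \<times> {..<m}) \<times> T"
  have "inj_on ?f ?D"
  proof (rule inj_on_inverseI[where g = "\<lambda>(x, y). ((nat (x div int k), nat (y div int k)),
                                            (nat (x mod int k), nat (y mod int k)))"])
    fix t assume "t \<in> ?D"
    then show "(case ?f t of (x, y) \<Rightarrow> ((nat (x div int k), nat (y div int k)),
                                            (nat (x mod int k), nat (y mod int k)))) = t"
      using T by auto
  qed
  moreover have "?f ` ?D \<subseteq> torus_proj k -` T \<inter> square (0, 0) (k * m)"
  proof -
    have lt: "int a + int k * int i < int k * int m" if "a < k" "i < m" for a i
    proof -
      have "a + k * i < k * Suc i" using that by simp
      also have "\<dots> \<le> k * m" using that by (intro mult_le_mono2) simp
      finally show ?thesis by (metis of_nat_add of_nat_less_iff of_nat_mult)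
    qed
    show ?thesis
      using T by (auto simp: torus_proj_def residue_int square_def intro!: lt)
  qed
  ultimately have "card ?D \<le> card (torus_proj k -` T \<inter> square (0, 0) (k * m))"
    by (rule card_inj_on_le) simp
  then show ?thesis by (simp add: card_cartesian_product power2_eq_square)
qed

lemma alpha_od_le_rho_od_grid:
  assumes k: "k \<ge> 3"
  shows "ereal (real (alpha_od (cycle_graph k \<box> cycle_graph k)) / real k ^ 2) \<le> rho_od_grid"
proof -
  let ?C = "cycle_graph k \<box> cycle_graph k"
  obtain T where T: "odd_independent ?C T" "card T = alpha_od ?C"
    using alpha_od_attained[of ?C] by (auto simp: verts_cycle_square)
  then have T_sub: "T \<subseteq> {..<k} \<times> {..<k}"
    by (simp add: odd_independent_def independent_def verts_cycle_square)
  define S where "S = torus_proj k -` T"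
  let ?f = "\<lambda>n. SUP p. ereal (real (card (S \<inter> square p n)) / real (card (square p n)))"
  \<comment> \<open>It suffices to look at the squares at the origin whose side is a multiple of the period.\<close>
  define r where "r = (\<lambda>m. k * Suc m)"
  have "ereal (real (card T) / real k ^ 2) \<le> ?f (r m)" for m
  proof (rule SUP_upper2[of "(0, 0)"])
    have "real ((Suc m)\<^sup>2 * card T) \<le> real (card (S \<inter> square (0, 0) (r m)))"
      unfolding r_def S_def by (intro of_nat_mono card_periodic_square T_sub)
    then have "real ((Suc m)\<^sup>2 * card T) / real ((r m)\<^sup>2)
                 \<le> real (card (S \<inter> square (0, 0) (r m))) / real ((r m)\<^sup>2)"
      by (rule divide_right_mono) simp
    also have "real ((Suc m)\<^sup>2 * card T) / real ((r m)\<^sup>2) = real (card T) / real k ^ 2"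
      unfolding r_def of_nat_mult of_nat_power power_mult_distrib
      by (simp del: of_nat_Suc)
    finally show "ereal (real (card T) / real k ^ 2)
        \<le> ereal (real (card (S \<inter> square (0, 0) (r m))) / real (card (square (0, 0) (r m))))"
      by (simp add: power2_eq_square)
  qed simp
  then have "ereal (real (card T) / real k ^ 2) \<le> limsup (?f \<circ> r)"
    by (intro le_Limsup) auto
  also have "\<dots> \<le> limsup ?f"
    using k by (intro limsup_subseq_mono strict_monoI) (simp add: r_def)
  also have "\<dots> = upper_density S"
    by (simp add: upper_density_def)
  also have "\<dots> \<le> rho_od_grid"
    unfolding rho_od_grid_def S_def
    by (intro SUP_upper) (simp add: odd_independent_periodic k T)
  finally show ?thesis by (simp add: T)
qed

text \<open>
  The six vertices with even coordinate sum other than \<open>(0, 0)\<close> and \<open>(2, 2)\<close>: each vertex with odd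
  coordinate sum has exactly one of these two as a neighbour, so it has three neighbours in the set.
\<close>

lemma alpha_od_torus_4_ge: "6 \<le> alpha_od (cycle_graph 4 \<box> cycle_graph 4)"
proof -
  let ?C = "cycle_graph 4 \<box> cycle_graph 4"
  define T :: "(nat \<times> nat) set" where "T = {(0, 2), (2, 0), (1, 1), (1, 3), (3, 1), (3, 3)}"
  have V: "verts ?C = {0, 1, 2, 3} \<times> {0, 1, 2, 3}"
    unfolding verts_cycle_square by (simp add: lessThan_nat_numeral lessThan_Suc insert_commute)
  have T_sub: "T \<subseteq> verts ?C"
    by (simp add: T_def V)
  have adj: "adj ?C (a, b) (c, d) \<longleftrightarrow>
      a = c \<and> a < 4 \<and> b < 4 \<and> d < 4 \<and> (d = Suc b mod 4 \<or> b = Suc d mod 4) \<or>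
      b = d \<and> b < 4 \<and> a < 4 \<and> c < 4 \<and> (c = Suc a mod 4 \<or> a = Suc c mod 4)" for a b c d
    by (auto simp: cart_prod_def cycle_graph_def)
  have "\<forall>u\<in>T. \<forall>v\<in>T. \<not> adj ?C u v"
    by (simp add: T_def adj)
  moreover have "\<forall>v\<in>verts ?C. v \<notin> T \<longrightarrow> (\<Sum>u\<in>T. of_bool (adj ?C v u)) \<in> {0::nat, 3}"
    unfolding V by (simp add: T_def adj)
  moreover have "card (nbhd ?C v \<inter> T) = (\<Sum>u\<in>T. of_bool (adj ?C v u))" for v
  proof -
    have "nbhd ?C v \<inter> T = T \<inter> {u. adj ?C v u}"
      using T_sub by (auto simp: nbhd_def)
    then show ?thesis by (simp add: T_def sum_of_bool_eq)
  qed
  moreover have "finite (nbhd ?C v \<inter> T)" for v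
    by (simp add: T_def)
  ultimately have "odd_independent ?C T"
    using T_sub unfolding odd_independent_def independent_def
    by (metis DiffE card_0_eq insertE odd_numeral singletonD)
  then have "card T \<le> alpha_od ?C"
    by (intro card_le_alpha_od) (simp_all add: verts_cycle_square)
  then show ?thesis by (simp add: T_def)
qed

theorem corollary12:
  shows "ereal (real (alpha_od (cycle_graph 4 \<box> cycle_graph 4)) / 4 ^ 2) \<le> rho_od_grid
       \<and> rho_od_grid \<le> ereal (real (alpha_iod (path_graph 26 \<box> path_graph 26)) / 26 ^ 2)
       \<and> ereal (3 / 8) \<le> rho_od_grid
       \<and> rho_od_grid \<le> ereal (260 / 676)
       \<and> (260 / 676 :: real) = 5 / 13"
proof (intro conjI)
  let ?a = "alpha_od (cycle_graph 4 \<box> cycle_graph 4)"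
  show lower: "ereal (real ?a / 4 ^ 2) \<le> rho_od_grid"
    using alpha_od_le_rho_od_grid[of 4] by simp
  show "rho_od_grid \<le> ereal (real (alpha_iod (path_graph 26 \<box> path_graph 26)) / 26 ^ 2)"
    using rho_od_grid_le_alpha_iod[of 26] by simp
  have "ereal (3 / 8) \<le> ereal (real ?a / 4 ^ 2)"
    using alpha_od_torus_4_ge by simp
  then show "ereal (3 / 8) \<le> rho_od_grid"
    using lower by (rule order_trans)
  show "rho_od_grid \<le> ereal (260 / 676)"
    using rho_od_grid_le_5_13 by simp
  show "(260 / 676 :: real) = 5 / 13" by simp
qed

end
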